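(* Let $b\geq 5$ be an odd integer and $n=5b$. Then $\mathrm{MiD}(L_{5,b})=\frac{n-5}{2}$.
   Context: A Latin square of order $n$ is an $n\times n$ array with entries from $\{1,2,\dots,n\}$ such that each row and each column contains every symbol exactly once. For positive integers $a,b$ and $n=ab$, an $(a,b)$-Sudoku Latin square is a Latin square of order $n$ such that, when the array is tiled by $a\times b$ blocks ($a$ consecutive rows $ka+1,\dots,(k+1)a$ by $b$ consecutive columns $lb+1,\dots,(l+1)b$), each block contains every symbol of $\{1,\dots,n\}$ exactly once. Two cells are adjacent if they share an edge horizontally or vertically (no wrap-around). The distance between two adjacent cells containing symbols $u,v$ is $\min\{(u-v)\bmod n,\ (v-u)\bmod n\}$, residues being taken in $\{0,\dots,n-1\}$. The inner distance of a Latin square of order $n\ge2$ is the minimum of the distances over all pairs of adjacent cells. $\mathrm{MiD}(L_{a,b})$ denotes the maximum of the inner distances of all $(a,b)$-Sudoku Latin squares. *)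

theory Defs
  imports Complex_Main
begin

text \<open>
  Cells are pairs (row, column), numbered from 1. An array of order n is a function on all pairs
  of which only the values on \<open>{1..n} \<times> {1..n}\<close> matter.
\<close>

type_synonym cell = "nat \<times> nat"

definition each_symbol_once :: "nat \<Rightarrow> (cell \<Rightarrow> nat) \<Rightarrow> cell set \<Rightarrow> bool" where
  "each_symbol_once n L C \<longleftrightarrow> (\<forall>s\<in>{1..n}. \<exists>!c. c \<in> C \<and> L c = s)"

definition latin_square :: "nat \<Rightarrow> (cell \<Rightarrow> nat) \<Rightarrow> bool" where
  "latin_square n L \<longleftrightarrow>
     (\<forall>c\<in>{1..n} \<times> {1..n}. L c \<in> {1..n}) \<and>
     (\<forall>i\<in>{1..n}. each_symbol_once n L ({i} \<times> {1..n})) \<and>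
     (\<forall>j\<in>{1..n}. each_symbol_once n L ({1..n} \<times> {j}))"

text \<open>
  With \<open>n = a * b\<close> there are b horizontal bands of a rows and a vertical bands of b columns.
\<close>

definition block :: "nat \<Rightarrow> nat \<Rightarrow> nat \<Rightarrow> nat \<Rightarrow> cell set" where
  "block a b k l = {k * a + 1..(k + 1) * a} \<times> {l * b + 1..(l + 1) * b}"

definition sudoku_latin_square :: "nat \<Rightarrow> nat \<Rightarrow> (cell \<Rightarrow> nat) \<Rightarrow> bool" where
  "sudoku_latin_square a b L \<longleftrightarrow>
     latin_square (a * b) L \<and>
     (\<forall>k<b. \<forall>l<a. each_symbol_once (a * b) L (block a b k l))"

definition adjacent :: "cell \<Rightarrow> cell \<Rightarrow> bool" where
  "adjacent c d \<longleftrightarrow>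
     fst c = fst d \<and> (snd d = snd c + 1 \<or> snd c = snd d + 1) \<or>
     snd c = snd d \<and> (fst d = fst c + 1 \<or> fst c = fst d + 1)"

text \<open>Over the integers, so that subtraction is not truncated and residues lie in \<open>{0..<n}\<close>.\<close>

definition symbol_dist :: "nat \<Rightarrow> nat \<Rightarrow> nat \<Rightarrow> int" where
  "symbol_dist n u v = min ((int u - int v) mod int n) ((int v - int u) mod int n)"

text \<open>Meaningful for \<open>n \<ge> 2\<close> only, since otherwise there are no adjacent cells.\<close>

definition inner_distance :: "nat \<Rightarrow> (cell \<Rightarrow> nat) \<Rightarrow> int" where
  "inner_distance n L =
     Min {symbol_dist n (L c) (L d) | c d.
            c \<in> {1..n} \<times> {1..n} \<and> d \<in> {1..n} \<times> {1..n} \<and> adjacent c d}"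

text \<open>
  For \<open>a * b \<ge> 2\<close> all inner distances lie in \<open>{0..<a * b}\<close>, so the maximum is over a finite set.
\<close>

definition MiD_sudoku :: "nat \<Rightarrow> nat \<Rightarrow> int" where
  "MiD_sudoku a b = Max {inner_distance (a * b) L | L. sudoku_latin_square a b L}"

end

theory Submission
  imports Defs "HOL-Number_Theory.Cong"
begin

text \<open>
  Let \<open>n = a * b\<close> be odd. Multiplication by 2 permutes the residues modulo \<open>n\<close> and turns the large
  distances into small ones: two symbols are at distance at least \<open>(n - k) / 2\<close> iff their doubled
  difference is congruent to an odd integer of absolute value at most \<open>k\<close> (\<open>symbol_dist_ge_iff\<close>).
  The theorem says that, for \<open>a = 5\<close>, steps of \<open>\<plusminus>1, \<plusminus>3, \<plusminus>5\<close> between adjacent doubled symbols suffice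
  to build a Sudoku Latin square, whereas steps of \<open>\<plusminus>1, \<plusminus>3\<close> do not.

  Upper bound (\<open>inner_distance_upper_bound\<close>). Suppose that all steps are \<open>\<plusminus>1\<close> or \<open>\<plusminus>3\<close>. Within
  \<open>d\<close> steps from the centre of a block the doubled symbol changes by an integer of absolute value
  at most \<open>3 * d\<close> and of the parity of \<open>d\<close>. All cells of an \<open>a \<times> b\<close> block with odd sides lie within
  \<open>D = (a + b) / 2 - 1\<close> steps from its centre. A change by \<open>3 * D - 1\<close> therefore needs \<open>D\<close> steps, for
  which it has the wrong parity; and when \<open>6 * D - 1 < n\<close>, no other representative of that residue is
  small enough. So some symbol is missing from the block. For odd sides, both at least 5, the
  condition \<open>6 * D - 1 < n\<close> holds.

  Lower bound (\<open>sudoku_latin_square_exists\<close>). For odd sides, let the doubled symbol increase by 1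
  from each row to the next, by \<open>a\<close> from each column to the next inside a band of \<open>b\<close> columns, and
  by 1 between bands. A band then meets each row in one full residue class modulo \<open>a\<close>, the
  class changes by 1 from band to band, and also from row to row. Hence the rows and the blocks are
  complete, and the columns run through consecutive residues. All steps are 1 or \<open>a\<close>.
\<close>

section \<open>Distances and doubled symbols\<close>

lemma dvd_diff_imp_eq:
  fixes x y :: int
  assumes "m dvd x - y" "\<bar>x - y\<bar> < m"
  shows "x = y"
  using assms dvd_imp_le_int[of "x - y" m] by fastforce

lemma cong_double_half:
  fixes n :: nat and x :: int
  assumes "odd n"
  shows "[2 * ((int n + 1) div 2 * x) = x] (mod int n)"
proof -
  have "2 * ((int n + 1) div 2) = int n + 1"
    using assms by presburger
  then have "2 * ((int n + 1) div 2 * x) = (int n + 1) * x"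
    by (simp only: mult.assoc[symmetric])
  then show ?thesis
    by (simp add: cong_iff_dvd_diff distrib_right)
qed

text \<open>
  If \<open>r\<close> is the residue of \<open>u - v\<close>, then \<open>2 * r - n\<close> represents the doubled difference; it is odd
  because \<open>n\<close> is, and it measures how far \<open>r\<close> is from the middle of \<open>{0..n}\<close>.
\<close>

lemma symbol_dist_ge_iff:
  fixes n k u v :: nat
  assumes "odd n" and "k < n"
  shows "int n - int k \<le> 2 * symbol_dist n u v \<longleftrightarrow>
    (\<exists>e. odd e \<and> \<bar>e\<bar> \<le> int k \<and> [2 * (int u - int v) = e] (mod int n))"
    (is "?far \<longleftrightarrow> ?odd")
proof -
  define N where "N = int n"
  define r where "r = (int u - int v) mod N"
  have N: "0 < N" "odd N" "int k < N"
    using assms by (auto simp: N_def)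
  have r: "0 \<le> r" "r < N"
    using N by (auto simp: r_def)
  have neg: "(int v - int u) mod N = (if r = 0 then 0 else N - r)"
    using zmod_zminus1_eq_if[of "int u - int v" N] by (simp add: r_def)
  have dist: "symbol_dist n u v = (if r = 0 then 0 else min r (N - r))"
    unfolding symbol_dist_def N_def[symmetric] neg r_def[symmetric] using r by auto
  have dbl: "[2 * (int u - int v) = e] (mod N) \<longleftrightarrow> N dvd 2 * r - e" for e
  proof -
    have "[2 * (int u - int v) = 2 * r] (mod N)"
      unfolding r_def by (intro cong_mult) (auto simp: cong_def)
    then show ?thesis
      by (metis cong_iff_dvd_diff cong_sym cong_trans)
  qed
  show ?thesis
  proof
    assume far: ?far
    then have "r \<noteq> 0" "N - int k \<le> 2 * r" "N - int k \<le> 2 * (N - r)"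
      using N by (auto simp: dist N_def[symmetric] min_def split: if_splits)
    then have "odd (2 * r - N) \<and> \<bar>2 * r - N\<bar> \<le> int k \<and> N dvd 2 * r - (2 * r - N)"
      using N by auto
    then show ?odd
      unfolding N_def[symmetric] dbl by blast
  next
    assume ?odd
    then obtain e where e: "odd e" "\<bar>e\<bar> \<le> int k" "N dvd 2 * r - e"
      using dbl by (auto simp: N_def[symmetric])
    then obtain t where t: "2 * r - e = N * t"
      by (auto simp: dvd_def)
    \<comment> \<open>Parity excludes \<open>t = 0\<close> and \<open>t = 2\<close>, size everything else but \<open>t = 1\<close>.\<close>
    have "odd (N * t)"
      using e(1) by (simp flip: t)
    then have "odd t" by simp
    have "N * t < N * 3" "N * (-1) < N * t"
      using t r e(2) N by linarith+
    then have "t < 3" "-1 < t"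
      using N by (simp_all only: mult_less_cancel_left_pos)
    with \<open>odd t\<close> have "t = 1"
      by presburger
    then have "2 * r = N + e"
      using t by simp
    then show ?far
      using e(2) N r by (auto simp: dist N_def[symmetric] min_def)
  qed
qed

lemma symbol_dist_bounds:
  assumes "0 < n"
  shows "0 \<le> symbol_dist n u v" "symbol_dist n u v < int n"
  using assms by (auto simp: symbol_dist_def min_less_iff_disj)

lemma inner_distance_set:
  assumes "2 \<le> n"
  defines "S L \<equiv> {symbol_dist n (L c) (L d) | c d.
            c \<in> {1..n} \<times> {1..n} \<and> d \<in> {1..n} \<times> {1..n} \<and> adjacent c d}"
  shows "finite (S L)" "S L \<noteq> {}"
proof -
  have "S L \<subseteq> (\<lambda>(c, d). symbol_dist n (L c) (L d)) ` (({1..n} \<times> {1..n}) \<times> ({1..n} \<times> {1..n}))"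
    by (force simp: S_def)
  then show "finite (S L)"
    by (rule finite_subset) simp
  have "(1, 1) \<in> {1..n} \<times> {1..n}" "(1, 2) \<in> {1..n} \<times> {1..n}" "adjacent (1, 1) (1, 2)"
    using assms by (auto simp: adjacent_def)
  then show "S L \<noteq> {}"
    unfolding S_def by blast
qed

lemma inner_distance_ge_iff:
  assumes "2 \<le> n"
  shows "x \<le> inner_distance n L \<longleftrightarrow>
    (\<forall>c\<in>{1..n} \<times> {1..n}. \<forall>d\<in>{1..n} \<times> {1..n}. adjacent c d \<longrightarrow> x \<le> symbol_dist n (L c) (L d))"
  unfolding inner_distance_def
  by (subst Min_ge_iff[OF inner_distance_set[OF assms]]) blast

lemma inner_distance_bounds:
  assumes "2 \<le> n"
  shows "0 \<le> inner_distance n L" "inner_distance n L < int n"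
  using Min_in[OF inner_distance_set[OF assms, of L]] symbol_dist_bounds[of n] assms
  by (auto simp: inner_distance_def)

section \<open>The upper bound\<close>

text \<open>
  The differences of symbols that can arise between the ends of a walk of \<open>d\<close> steps, when each step
  changes the doubled symbol by \<open>\<plusminus>1\<close> or \<open>\<plusminus>3\<close>. Only size and parity of the total change are recorded.
\<close>

definition reachable :: "nat \<Rightarrow> nat \<Rightarrow> int \<Rightarrow> bool" where
  "reachable n d x \<longleftrightarrow> (\<exists>z. \<bar>z\<bar> \<le> 3 * int d \<and> even (z - int d) \<and> [2 * x = z] (mod int n))"

lemma reachable_0: "reachable n 0 0"
  by (auto simp: reachable_def intro: exI[of _ 0])

lemma reachable_add:
  assumes "reachable n d x" "reachable n e y"
  shows "reachable n (d + e) (x + y)"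
proof -
  obtain z w where
    "\<bar>z\<bar> \<le> 3 * int d" "even (z - int d)" "[2 * x = z] (mod int n)"
    "\<bar>w\<bar> \<le> 3 * int e" "even (w - int e)" "[2 * y = w] (mod int n)"
    using assms by (auto simp: reachable_def)
  then have "\<bar>z + w\<bar> \<le> 3 * int (d + e) \<and> even (z + w - int (d + e)) \<and>
      [2 * (x + y) = z + w] (mod int n)"
    using cong_add[of "2 * x" z "int n" "2 * y" w] by (auto simp: distrib_left)
  then show ?thesis
    unfolding reachable_def by blast
qed

lemma reachable_uminus:
  assumes "reachable n d x"
  shows "reachable n d (- x)"
proof -
  obtain z where "\<bar>z\<bar> \<le> 3 * int d" "even (z - int d)" "[2 * x = z] (mod int n)"
    using assms by (auto simp: reachable_def)
  then have "\<bar>- z\<bar> \<le> 3 * int d \<and> even (- z - int d) \<and> [2 * - x = - z] (mod int n)"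
    by (auto simp: cong_minus_minus_iff)
  then show ?thesis
    unfolding reachable_def by blast
qed

lemma reachable_walk_up:
  assumes "i \<le> j" and "\<And>k. i \<le> k \<Longrightarrow> k < j \<Longrightarrow> reachable n 1 (v (Suc k) - v k)"
  shows "reachable n (j - i) (v j - v i)"
  using assms
proof (induction j rule: dec_induct)
  case base
  show ?case using reachable_0 by simp
next
  case (step j)
  then have "reachable n (j - i + 1) ((v j - v i) + (v (Suc j) - v j))"
    by (intro reachable_add) auto
  then show ?case
    using step.hyps by (simp add: Suc_diff_le)
qed

lemma reachable_walk:
  assumes "i \<in> {lo..hi}" "j \<in> {lo..hi}"
    and "\<And>k. lo \<le> k \<Longrightarrow> k < hi \<Longrightarrow> reachable n 1 (v (Suc k) - v k)"
  shows "reachable n (nat \<bar>int j - int i\<bar>) (v j - v i)"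
proof (cases "i \<le> j")
  case True
  then show ?thesis
    using reachable_walk_up[of i j n v] assms by (simp add: nat_diff_distrib')
next
  case False
  then have "reachable n (i - j) (v i - v j)"
    using reachable_walk_up[of j i n v] assms by auto
  from reachable_uminus[OF this] show ?thesis
    using False by (simp add: nat_diff_distrib')
qed

text \<open>
  A single block already contains the contradiction, and the argument starts at its centre because
  the centre minimises the largest distance to another cell of the block.
\<close>

lemma inner_distance_upper_bound:
  fixes a b :: nat
  assumes ab: "5 \<le> a" "5 \<le> b" "odd a" "odd b" and L: "sudoku_latin_square a b L"
  shows "2 * inner_distance (a * b) L \<le> int (a * b) - 5"
proof (rule ccontr)
  assume large: "\<not> ?thesis"
  define n where "n = a * b"
  have "odd n"
    using ab by (simp add: n_def)
  have sizes: "25 \<le> n" "a \<le> n" "b \<le> n"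
    using ab mult_le_mono[of 5 a 5 b] by (auto simp: n_def)
  \<comment> \<open>\<open>n - 5\<close> is even, so twice a distance above it is at least \<open>n - 3\<close>.\<close>
  have "int n - 3 \<le> 2 * inner_distance n L"
    using large \<open>odd n\<close> unfolding n_def by presburger
  then have far: "int n - int 3 \<le> 2 * symbol_dist n (L c) (L d)"
    if "c \<in> {1..n} \<times> {1..n}" "d \<in> {1..n} \<times> {1..n}" "adjacent c d" for c d
    using inner_distance_ge_iff[of n "inner_distance n L" L] sizes that by fastforce
  have step: "reachable n 1 (int (L c) - int (L d))"
    if "c \<in> {1..n} \<times> {1..n}" "d \<in> {1..n} \<times> {1..n}" "adjacent c d" for c d
    using symbol_dist_ge_iff[OF \<open>odd n\<close>, of 3] far[OF that] sizes
    by (auto simp: reachable_def)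
  obtain p q where pq: "a = 2 * p + 1" "b = 2 * q + 1"
    using ab by (auto elim!: oddE)
  define D where "D = p + q"
  \<comment> \<open>This is \<open>(a - 3) * (b - 3) > 2\<close>.\<close>
  have D: "6 * int D - 1 < int n"
  proof -
    have "0 \<le> (int p - 2) * (int q - 2)"
      using pq ab by (intro mult_nonneg_nonneg) auto
    then show ?thesis
      using pq ab by (simp add: n_def D_def algebra_simps)
  qed
  define c0 where "c0 = (p + 1, q + 1)"
  have reach: "\<exists>d\<le>D. reachable n d (int (L c) - int (L c0))"
    if "c \<in> block a b 0 0" for c
  proof -
    obtain i j where c: "c = (i, j)"
      by (cases c)
    with that have ij: "i \<in> {1..a}" "j \<in> {1..b}"
      by (auto simp: block_def)
    have "reachable n (nat \<bar>int i - int (p + 1)\<bar>) (int (L (i, j)) - int (L (p + 1, j)))"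
      using ij pq sizes
      by (intro reachable_walk[where v = "\<lambda>i. int (L (i, j))" and lo = 1 and hi = a] step)
        (auto simp: adjacent_def)
    moreover have "reachable n (nat \<bar>int j - int (q + 1)\<bar>)
        (int (L (p + 1, j)) - int (L (p + 1, q + 1)))"
      using ij pq sizes
      by (intro reachable_walk[where v = "\<lambda>j. int (L (p + 1, j))" and lo = 1 and hi = b] step)
        (auto simp: adjacent_def)
    ultimately have "reachable n (nat \<bar>int i - int (p + 1)\<bar> + nat \<bar>int j - int (q + 1)\<bar>)
        (int (L c) - int (L c0))"
      using reachable_add by (fastforce simp: c c0_def)
    moreover have "nat \<bar>int i - int (p + 1)\<bar> + nat \<bar>int j - int (q + 1)\<bar> \<le> D"
      using ij pq by (auto simp: D_def)
    ultimately show ?thesis by blast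
  qed
  \<comment> \<open>Since \<open>h\<close> is the inverse of 2, \<open>s\<close> is the symbol whose doubled difference to the central symbol
    is \<open>3 * D - 1\<close>; reduction before adding 1 gives the representative in \<open>{1..n}\<close>.\<close>
  define h where "h = (int n + 1) div 2"
  define s where "s = nat ((int (L c0) + h * (3 * int D - 1) - 1) mod int n) + 1"
  have "0 < int n" using sizes by simp
  have s: "s \<in> {1..n}"
    using pos_mod_bound[OF \<open>0 < int n\<close>] pos_mod_sign[OF \<open>0 < int n\<close>]
    by (simp add: s_def Suc_le_eq nat_less_iff)
  have "[int s - int (L c0) = h * (3 * int D - 1)] (mod int n)"
  proof -
    have "int s - 1 = (int (L c0) + h * (3 * int D - 1) - 1) mod int n"
      using pos_mod_sign[OF \<open>0 < int n\<close>] by (simp add: s_def)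
    then have "[int s - 1 = int (L c0) + h * (3 * int D - 1) - 1] (mod int n)"
      by (simp add: cong_def)
    then show ?thesis
      by (simp add: cong_iff_dvd_diff algebra_simps)
  qed
  then have "[2 * (int s - int (L c0)) = 2 * (h * (3 * int D - 1))] (mod int n)"
    by (intro cong_mult) auto
  also have "[2 * (h * (3 * int D - 1)) = 3 * int D - 1] (mod int n)"
    unfolding h_def by (rule cong_double_half[OF \<open>odd n\<close>])
  finally have target: "[2 * (int s - int (L c0)) = 3 * int D - 1] (mod int n)" .
  have "0 < a" "0 < b"
    using ab by linarith+
  then have "each_symbol_once n L (block a b 0 0)"
    using L unfolding sudoku_latin_square_def n_def by blast
  then obtain c where c: "c \<in> block a b 0 0" "L c = s"
    using s unfolding each_symbol_once_def by blast
  obtain d z where d: "d \<le> D" "\<bar>z\<bar> \<le> 3 * int d" "even (z - int d)"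
      and z: "[2 * (int s - int (L c0)) = z] (mod int n)"
    using reach[OF c(1)] unfolding reachable_def c(2) by blast
  have "int n dvd 3 * int D - 1 - z"
    using target z by (metis cong_iff_dvd_diff cong_sym cong_trans)
  moreover have "\<bar>3 * int D - 1 - z\<bar> < int n"
    using d D sizes by auto
  ultimately have z_eq: "z = 3 * int D - 1"
    using dvd_diff_imp_eq by fastforce
  \<comment> \<open>Size forces the distance to be maximal, and then the parity is wrong.\<close>
  then have "d = D"
    using d by linarith
  then show False
    using d(3) z_eq by presburger
qed

section \<open>A Sudoku Latin square attaining the bound\<close>

lemma each_symbol_onceI:
  assumes "finite C" "card C = n" "inj_on L C" "L ` C \<subseteq> {1..n}"
  shows "each_symbol_once n L C"
proof -
  have "L ` C = {1..n}"
    using assms by (intro card_subset_eq) (auto simp: card_image)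
  then show ?thesis
    using assms(3) unfolding each_symbol_once_def inj_on_def by (metis imageE)
qed

text \<open>
  Twice the symbol of the square constructed below, modulo \<open>a * b\<close> and up to an additive constant.
  The last term makes the step across the border of two column bands \<open>a - (a - 1) = 1\<close>.
\<close>

definition doubled_symbol :: "nat \<Rightarrow> nat \<Rightarrow> cell \<Rightarrow> int" where
  "doubled_symbol a b = (\<lambda>(i, j). int i + int a * int j - (int a - 1) * int ((j - 1) div b))"

lemma same_quotient_close:
  assumes "x div b = y div b" "0 < b"
  shows "\<bar>int x - int y\<bar> < int b"
proof -
  have "int z = int b * int (z div b) + int (z mod b)" for z
    by (metis mult_div_mod_eq of_nat_add of_nat_mult)
  from this[of x] this[of y]
  have "int x - int y = int (x mod b) - int (y mod b)"
    using assms(1) by simp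
  moreover have "x mod b < b" "y mod b < b"
    using assms(2) by simp_all
  ultimately show ?thesis by linarith
qed

text \<open>
  Inside a band the column term is a multiple of \<open>a\<close> up to a constant. So the residue modulo \<open>a\<close>
  determines the row among \<open>a\<close> consecutive ones, and what remains determines the column.
\<close>

lemma doubled_symbol_inj_block:
  assumes "int (a * b) dvd doubled_symbol a b (i, j) - doubled_symbol a b (i', j')"
    and band: "(j - 1) div b = (j' - 1) div b" "1 \<le> j" "1 \<le> j'"
    and rows: "\<bar>int i - int i'\<bar> < int a" and pos: "0 < a" "0 < b"
  shows "i = i'" "j = j'"
proof -
  have dvd: "int a * int b dvd int i - int i' + int a * (int j - int j')"
    using assms by (simp add: doubled_symbol_def algebra_simps)
  then have "int a dvd int i - int i' + int a * (int j - int j')"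
    by (rule dvd_mult_left)
  then have "int a dvd int i - int i'"
    by (simp add: dvd_add_left_iff)
  then show "i = i'"
    using rows dvd_diff_imp_eq by fastforce
  then have "int b dvd int j - int j'"
    using dvd pos by simp
  moreover have "\<bar>int j - int j'\<bar> < int b"
    using same_quotient_close[OF band(1) pos(2)] band by (simp add: of_nat_diff)
  ultimately show "j = j'"
    using dvd_diff_imp_eq by fastforce
qed

text \<open>
  Along a row the residue modulo \<open>a\<close> identifies the band, because \<open>- (a - 1)\<close> is congruent to 1.
\<close>

lemma doubled_symbol_inj_row:
  assumes dvd: "int (a * b) dvd doubled_symbol a b (i, j) - doubled_symbol a b (i, j')"
    and j: "j \<in> {1..a * b}" "j' \<in> {1..a * b}"
  shows "j = j'"
proof -
  have pos: "0 < a" "0 < b"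
    using j by (auto intro: Nat.gr0I)
  define l where "l = int ((j - 1) div b) - int ((j' - 1) div b)"
  have "int a dvd doubled_symbol a b (i, j) - doubled_symbol a b (i, j')"
    using dvd by (metis dvd_mult_left of_nat_mult)
  also have "doubled_symbol a b (i, j) - doubled_symbol a b (i, j') = l + int a * (int j - int j' - l)"
    by (simp add: doubled_symbol_def l_def algebra_simps)
  finally have "int a dvd l"
    by (simp add: dvd_add_left_iff)
  moreover have "(j - 1) div b < a" "(j' - 1) div b < a"
    using j pos by (auto simp: less_mult_imp_div_less)
  ultimately have "(j - 1) div b = (j' - 1) div b"
    using dvd_diff_imp_eq[of "int a" "int ((j - 1) div b)" "int ((j' - 1) div b)"]
    by (auto simp: l_def)
  then show ?thesis
    using doubled_symbol_inj_block[OF dvd] j pos by auto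
qed

lemma doubled_symbol_step:
  assumes cd: "adjacent c d" "1 \<le> snd c" "1 \<le> snd d" and a: "odd a"
  shows "odd (doubled_symbol a b c - doubled_symbol a b d) \<and> \<bar>doubled_symbol a b c - doubled_symbol a b d\<bar> \<le> int a"
proof -
  have a1: "1 \<le> int a" using a by (cases a) auto
  have right: "\<exists>x\<in>{1, int a}. doubled_symbol a b (i, Suc j) = doubled_symbol a b (i, j) + x" if "1 \<le> j" for i j
  proof -
    have "j div b = (j - 1) div b \<or> j div b = Suc ((j - 1) div b)"
      using div_Suc[of "j - 1" b] that by (auto split: if_splits)
    then show ?thesis
      by (auto simp: doubled_symbol_def algebra_simps)
  qed
  obtain i j i' j' where c: "c = (i, j)" and d: "d = (i', j')"
    by (cases c, cases d)
  consider "i = i'" "j' = Suc j" | "i = i'" "j = Suc j'" | "j = j'" "i' = Suc i" | "j = j'" "i = Suc i'"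
    using cd by (auto simp: adjacent_def c d)
  then show ?thesis
  proof cases
    case 1
    then show ?thesis using right[of j i] cd a a1 by (auto simp: c d)
  next
    case 2
    then show ?thesis using right[of j' i] cd a a1 by (auto simp: c d)
  qed (use a1 in \<open>auto simp: c d doubled_symbol_def\<close>)
qed

text \<open>
  Halving modulo \<open>n\<close> turns \<open>doubled_symbol\<close> into an array of symbols, and its steps of \<open>\<plusminus>1\<close> and \<open>\<plusminus>a\<close>
  into distances \<open>(n - 1) / 2\<close> and \<open>(n - a) / 2\<close>.
\<close>

lemma sudoku_latin_square_exists:
  fixes a b :: nat
  assumes ab: "odd a" "odd b" "3 \<le> b"
  shows "\<exists>L. sudoku_latin_square a b L \<and> int (a * b) - int a \<le> 2 * inner_distance (a * b) L"
proof -
  define n where "n = a * b"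
  have pos: "0 < a" "0 < b"
    using ab by (auto intro: Nat.gr0I)
  have "odd n" using ab by (simp add: n_def)
  have "a < n" using pos ab by (simp add: n_def)
  have "3 \<le> n" using pos ab mult_le_mono[of 1 a 3 b] by (simp add: n_def)
  then have n0: "0 < int n" by simp
  define h where "h = (int n + 1) div 2"
  define L where "L c = nat ((h * doubled_symbol a b c) mod int n) + 1" for c
  have L_range: "L c \<in> {1..n}" for c
    using pos_mod_bound[OF n0] pos_mod_sign[OF n0]
    by (simp add: L_def Suc_le_eq nat_less_iff)
  have L_diff: "[2 * (int (L c) - int (L d)) = doubled_symbol a b c - doubled_symbol a b d] (mod int n)" for c d
  proof -
    have "[int (L c) - 1 = h * doubled_symbol a b c] (mod int n)" for c
      using pos_mod_sign[OF n0] by (simp add: L_def cong_def)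
    from cong_diff[OF this[of c] this[of d]]
    have "[int (L c) - int (L d) = h * (doubled_symbol a b c - doubled_symbol a b d)] (mod int n)"
      by (simp add: algebra_simps)
    then have "[2 * (int (L c) - int (L d)) = 2 * (h * (doubled_symbol a b c - doubled_symbol a b d))] (mod int n)"
      by (intro cong_mult) auto
    also have "[2 * (h * (doubled_symbol a b c - doubled_symbol a b d)) = doubled_symbol a b c - doubled_symbol a b d] (mod int n)"
      unfolding h_def by (rule cong_double_half[OF \<open>odd n\<close>])
    finally show ?thesis .
  qed
  have L_eq: "int (a * b) dvd doubled_symbol a b c - doubled_symbol a b d" if "L c = L d" for c d
    using L_diff[of c d] that by (simp add: cong_iff_dvd_diff n_def dvd_diff_commute)
  have "each_symbol_once n L ({i} \<times> {1..n})" for i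
  proof (rule each_symbol_onceI)
    show "inj_on L ({i} \<times> {1..n})"
      using L_eq doubled_symbol_inj_row[of a b i] by (fastforce simp: inj_on_def n_def)
  qed (use L_range in auto)
  moreover have "each_symbol_once n L ({1..n} \<times> {j})" for j
  proof (rule each_symbol_onceI)
    have same: "i = i'" if i: "i \<in> {1..n}" "i' \<in> {1..n}" and "L (i, j) = L (i', j)" for i i'
    proof -
      have "int n dvd int i - int i'"
        using L_eq[of "(i, j)" "(i', j)"] that by (simp add: doubled_symbol_def n_def)
      then show ?thesis
        using i dvd_diff_imp_eq[of "int n" "int i" "int i'"] by auto
    qed
    show "inj_on L ({1..n} \<times> {j})"
      by (auto simp: inj_on_def intro!: same)
  qed (use L_range in \<open>auto simp: card_cartesian_product\<close>)
  moreover have "each_symbol_once n L (block a b k l)" for k l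
  proof (rule each_symbol_onceI)
    have band: "(j - 1) div b = l" "1 \<le> j" if "j \<in> {l * b + 1..(l + 1) * b}" for j
      using that pos by (auto intro!: div_nat_eqI simp: algebra_simps)
    show "inj_on L (block a b k l)"
    proof (rule inj_onI, clarify)
      fix i j i' j'
      assume ij: "(i, j) \<in> block a b k l" "(i', j') \<in> block a b k l" and "L (i, j) = L (i', j')"
      then have "int (a * b) dvd doubled_symbol a b (i, j) - doubled_symbol a b (i', j')"
        using L_eq by blast
      moreover have "\<bar>int i - int i'\<bar> < int a"
        using ij by (auto simp: block_def)
      ultimately show "i = i' \<and> j = j'"
        using doubled_symbol_inj_block[of a b i j i' j'] band ij pos by (auto simp: block_def)
    qed
    show "card (block a b k l) = n"
      by (simp add: block_def card_cartesian_product n_def)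
  qed (use L_range in \<open>auto simp: block_def\<close>)
  ultimately have "sudoku_latin_square a b L"
    using L_range by (simp add: sudoku_latin_square_def latin_square_def n_def)
  moreover have "int n - int a \<le> 2 * inner_distance n L"
  proof -
    have "(int n - int a) div 2 \<le> symbol_dist n (L c) (L d)"
      if "c \<in> {1..n} \<times> {1..n}" "d \<in> {1..n} \<times> {1..n}" "adjacent c d" for c d
    proof -
      have "1 \<le> snd c" "1 \<le> snd d"
        using that by auto
      then have "int n - int a \<le> 2 * symbol_dist n (L c) (L d)"
        using doubled_symbol_step[OF that(3)] ab L_diff[of c d]
        unfolding symbol_dist_ge_iff[OF \<open>odd n\<close> \<open>a < n\<close>] by blast
      then show ?thesis by linarith
    qed
    then have "(int n - int a) div 2 \<le> inner_distance n L"
      using inner_distance_ge_iff[of n _ L] \<open>3 \<le> n\<close> by simp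
    moreover have "even (int n - int a)"
      using \<open>odd n\<close> ab by simp
    ultimately show ?thesis by presburger
  qed
  ultimately show ?thesis
    by (auto simp: n_def)
qed

theorem theorem4p11:
  fixes b n :: nat
  assumes "b \<ge> 5" and "odd b" and "n = 5 * b"
  shows "real_of_int (MiD_sudoku 5 b) = (real n - 5) / 2"
proof -
  define S where "S = {inner_distance (5 * b) L | L. sudoku_latin_square 5 b L}"
  have upper: "2 * x \<le> int n - 5" if "x \<in> S" for x
    using that inner_distance_upper_bound[of 5 b] assms by (auto simp: S_def)
  obtain x where x: "x \<in> S" "int n - 5 \<le> 2 * x"
    using sudoku_latin_square_exists[of 5 b] assms by (auto simp: S_def)
  have "S \<subseteq> {0..<int n}"
    using inner_distance_bounds[of n] assms by (auto simp: S_def)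
  then have "finite S"
    by (rule finite_subset) simp
  then have "Max S = x"
    using x upper by (intro Max_eqI) force+
  moreover have "2 * x = int n - 5"
    using x upper by force
  ultimately show ?thesis
    by (simp add: MiD_sudoku_def S_def[symmetric])
qed

end
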